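(* Let $\alpha:I\to\mathbb{E}^3$ be a spatial quaternionic curve with arc-length parameter $s$, principal curvature $k$ and torsion $r$. Then $\alpha$ is a spatial quaternionic Mannheim curve if and only if there is a constant $\lambda\in\mathbb{R}$ such that $$k(s)=\lambda\left(k^2(s)+r^2(s)\right)\quad\text{for all } s\in I.$$
   Context: Let $Q_H$ be the algebra of real quaternions $q=a e_1+b e_2+c e_3+d$, with $e_1^2=e_2^2=e_3^2=-1$, $e_1e_2=e_3=-e_2e_1$, $e_2e_3=e_1=-e_3e_2$, $e_3e_1=e_2=-e_1e_3$. Let $\gamma$ be quaternionic conjugation, $\gamma q=-ae_1-be_2-ce_3+d$, and let $h(p,q)=\frac12(p\times\gamma q+q\times\gamma p)$ (where $\times$ is quaternion multiplication), which is the Euclidean inner product. The space $\mathbb{E}^3$ is identified with the spatial quaternions $\{p\in Q_H: p+\gamma p=0\}$. A spatial quaternionic curve is a smooth arc-length parametrized curve $\alpha:I\to\mathbb{E}^3$ on an interval $I\subset\mathbb{R}$ with nowhere-zero curvatures $k$ (principal curvature) and $r$ (torsion) and orthonormal Frenet frame $\{t,n,b\}$, $t=\alpha'$, satisfying $t'=kn$, $n'=-kt+rb$, $b'=-rn$. The corresponding objects for a second curve $\beta$ with arc-length parameter $s^*\in I^*$ are denoted $t^*,n^*,b^*,k^*,r^*$. A spatial quaternionic curve $\alpha(s)$, $s\in I$, is a spatial quaternionic Mannheim curve if there exist a spatial quaternionic curve $\beta(s^* )$, $s^*\in I^*$ (a spatial quaternionic Mannheim partner curve of $\alpha$), and a smooth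 bijection $s\mapsto s^*(s)$ from $I$ to $I^*$ with nowhere-zero derivative such that at corresponding points $n(s)$ and $b^*(s^* )$ are linearly dependent and the principal normal line of $\alpha$ at $\alpha(s)$ coincides with the binormal line of $\beta$ at $\beta(s^* )$, i.e. $\beta(s^*(s))=\alpha(s)+\lambda(s)n(s)$ for some smooth function $\lambda$.
   Formalization: The partner curve's principal curvature k* is allowed to vanish (its torsion r* is still nowhere zero), since otherwise a circular helix satisfies the relation but its only candidate partner is a straight line, the axis of the helix. *)

theory Defs
  imports "HOL-Analysis.Analysis"
begin

section \<open>Real quaternions\<close>

text \<open>
  The quaternion \<open>a e1 + b e2 + c e3 + d\<close> is the vector \<open>(a, b, c, d)\<close>: the scalar part is the
  fourth component. Addition, scaling, norm and topology are those of \<^typ>\<open>real ^ 4\<close>; the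
  library's \<open>*\<close> on this type is the componentwise product, not the product of quaternions.
\<close>

type_synonym quat = "real ^ 4"

definition qe1 :: quat where "qe1 = vector [1, 0, 0, 0]"
definition qe2 :: quat where "qe2 = vector [0, 1, 0, 0]"
definition qe3 :: quat where "qe3 = vector [0, 0, 1, 0]"

definition quat_of_real :: "real \<Rightarrow> quat" where
  "quat_of_real d = vector [0, 0, 0, d]"

definition qmult :: "quat \<Rightarrow> quat \<Rightarrow> quat" (infixl "\<otimes>\<^sub>Q" 70) where
  "p \<otimes>\<^sub>Q q = vector
     [p$1 * q$4 + p$4 * q$1 + (p$2 * q$3 - p$3 * q$2),
      p$2 * q$4 + p$4 * q$2 + (p$3 * q$1 - p$1 * q$3),
      p$3 * q$4 + p$4 * q$3 + (p$1 * q$2 - p$2 * q$1),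
      p$4 * q$4 - p$1 * q$1 - p$2 * q$2 - p$3 * q$3]"

definition qconj :: "quat \<Rightarrow> quat" where
  "qconj q = vector [- (q$1), - (q$2), - (q$3), q$4]"

definition quat_h :: "quat \<Rightarrow> quat \<Rightarrow> quat" where
  "quat_h p q = (1/2) *\<^sub>R (p \<otimes>\<^sub>Q qconj q + q \<otimes>\<^sub>Q qconj p)"

definition spatial_quats :: "quat set" where
  "spatial_quats = {p. p + qconj p = 0}"

lemma vector_4 [simp]:
  "(vector [a, b, c, d] :: 'a::zero ^ 4) $ 1 = a"
  "(vector [a, b, c, d] :: 'a::zero ^ 4) $ 2 = b"
  "(vector [a, b, c, d] :: 'a::zero ^ 4) $ 3 = c"
  "(vector [a, b, c, d] :: 'a::zero ^ 4) $ 4 = d"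
  by (simp_all add: vector_def)

lemmas quat_defs = qe1_def qe2_def qe3_def quat_of_real_def qmult_def qconj_def

lemma quat_decomp:
  "q = q$1 *\<^sub>R qe1 + q$2 *\<^sub>R qe2 + q$3 *\<^sub>R qe3 + quat_of_real (q$4)"
  by (simp add: vec_eq_iff forall_4 quat_defs)

lemma quat_relations:
  "qe1 \<otimes>\<^sub>Q qe1 = - quat_of_real 1" "qe2 \<otimes>\<^sub>Q qe2 = - quat_of_real 1" "qe3 \<otimes>\<^sub>Q qe3 = - quat_of_real 1"
  "qe1 \<otimes>\<^sub>Q qe2 = qe3" "qe2 \<otimes>\<^sub>Q qe1 = - qe3"
  "qe2 \<otimes>\<^sub>Q qe3 = qe1" "qe3 \<otimes>\<^sub>Q qe2 = - qe1"
  "qe3 \<otimes>\<^sub>Q qe1 = qe2" "qe1 \<otimes>\<^sub>Q qe3 = - qe2"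
  "quat_of_real x \<otimes>\<^sub>Q q = x *\<^sub>R q" "q \<otimes>\<^sub>Q quat_of_real x = x *\<^sub>R q"
  by (simp_all add: vec_eq_iff forall_4 quat_defs)

lemma quat_h_inner: "quat_h p q = quat_of_real (p \<bullet> q)"
  by (simp add: vec_eq_iff forall_4 quat_defs quat_h_def inner_vec_def sum_4 field_simps)

lemma spatial_quats_iff: "p \<in> spatial_quats \<longleftrightarrow> p$4 = 0"
  by (simp add: spatial_quats_def vec_eq_iff forall_4 quat_defs)


section \<open>Curves\<close>

definition real_interval :: "real set \<Rightarrow> bool" where
  "real_interval I \<longleftrightarrow> is_interval I \<and> interior I \<noteq> {}"

text \<open>Infinitely differentiable on \<open>I\<close>, one-sidedly at end points belonging to \<open>I\<close>.\<close>

definition smooth_on_interval :: "real set \<Rightarrow> (real \<Rightarrow> 'a::real_normed_vector) \<Rightarrow> bool" where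
  "smooth_on_interval I f \<longleftrightarrow>
     (\<exists>F :: nat \<Rightarrow> real \<Rightarrow> 'a.
        (\<forall>s\<in>I. F 0 s = f s) \<and>
        (\<forall>m. \<forall>s\<in>I. (F m has_vector_derivative F (Suc m) s) (at s within I)))"

definition quat_orthonormal :: "quat \<Rightarrow> quat \<Rightarrow> quat \<Rightarrow> bool" where
  "quat_orthonormal u v w \<longleftrightarrow>
     quat_h u u = quat_of_real 1 \<and> quat_h v v = quat_of_real 1 \<and> quat_h w w = quat_of_real 1 \<and>
     quat_h u v = 0 \<and> quat_h u w = 0 \<and> quat_h v w = 0"

text \<open>
  A smooth curve in the spatial quaternions with a smooth orthonormal frame and curvatures
  satisfying the Frenet equations. The parameter is arc length because the derivative of the curve
  is the unit vector \<open>t\<close>. The curvatures may be zero here.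
\<close>

definition quat_frenet_curve ::
    "real set \<Rightarrow> (real \<Rightarrow> quat) \<Rightarrow> (real \<Rightarrow> quat) \<Rightarrow> (real \<Rightarrow> quat) \<Rightarrow> (real \<Rightarrow> quat)
      \<Rightarrow> (real \<Rightarrow> real) \<Rightarrow> (real \<Rightarrow> real) \<Rightarrow> bool" where
  "quat_frenet_curve I \<alpha> t n b k r \<longleftrightarrow>
     real_interval I \<and>
     smooth_on_interval I \<alpha> \<and> smooth_on_interval I t \<and> smooth_on_interval I n \<and>
     smooth_on_interval I b \<and>
     (\<forall>s\<in>I.
        {\<alpha> s, t s, n s, b s} \<subseteq> spatial_quats \<and>
        quat_orthonormal (t s) (n s) (b s) \<and>
        (\<alpha> has_vector_derivative t s) (at s within I) \<and>
        (t has_vector_derivative k s *\<^sub>R n s) (at s within I) \<and>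
        (n has_vector_derivative - (k s *\<^sub>R t s) + r s *\<^sub>R b s) (at s within I) \<and>
        (b has_vector_derivative - (r s *\<^sub>R n s)) (at s within I))"

definition spatial_quat_curve ::
    "real set \<Rightarrow> (real \<Rightarrow> quat) \<Rightarrow> (real \<Rightarrow> quat) \<Rightarrow> (real \<Rightarrow> quat) \<Rightarrow> (real \<Rightarrow> quat)
      \<Rightarrow> (real \<Rightarrow> real) \<Rightarrow> (real \<Rightarrow> real) \<Rightarrow> bool" where
  "spatial_quat_curve I \<alpha> t n b k r \<longleftrightarrow>
     quat_frenet_curve I \<alpha> t n b k r \<and> (\<forall>s\<in>I. k s \<noteq> 0 \<and> r s \<noteq> 0)"

definition line_through :: "quat \<Rightarrow> quat \<Rightarrow> quat set" where
  "line_through p v = range (\<lambda>x. p + x *\<^sub>R v)"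

text \<open>
  The partner curve \<open>\<beta>\<close> has a Frenet frame and nowhere-zero torsion \<open>r'\<close>, but its curvature \<open>k'\<close> may
  vanish. If \<open>k'\<close> had to be nowhere zero, a circular helix would satisfy \<open>k = \<lambda> (k\<^sup>2 + r\<^sup>2)\<close> with
  \<open>\<lambda> = k / (k\<^sup>2 + r\<^sup>2)\<close> without being a Mannheim curve: the only candidate for a partner is then
  \<open>\<alpha> + \<lambda> n\<close>, which is the axis of the helix. In general \<open>k'\<close> vanishes where \<open>k / r\<close> has
  derivative 0.

  Linear dependence of the two vectors is spelled out because the library's \<open>dependent {u, v}\<close> is
  false for \<open>u = v \<noteq> 0\<close>.
\<close>

definition mannheim_curve ::
    "real set \<Rightarrow> (real \<Rightarrow> quat) \<Rightarrow> (real \<Rightarrow> quat) \<Rightarrow> (real \<Rightarrow> quat) \<Rightarrow> (real \<Rightarrow> quat)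
      \<Rightarrow> (real \<Rightarrow> real) \<Rightarrow> (real \<Rightarrow> real) \<Rightarrow> bool" where
  "mannheim_curve I \<alpha> t n b k r \<longleftrightarrow>
     spatial_quat_curve I \<alpha> t n b k r \<and>
     (\<exists>J \<beta> t' n' b' k' r'. \<exists>\<phi> :: real \<Rightarrow> real. \<exists>lam :: real \<Rightarrow> real.
        quat_frenet_curve J \<beta> t' n' b' k' r' \<and> (\<forall>s\<in>J. r' s \<noteq> 0) \<and>
        bij_betw \<phi> I J \<and> smooth_on_interval I \<phi> \<and>
        (\<forall>s\<in>I. \<exists>d. d \<noteq> 0 \<and> (\<phi> has_real_derivative d) (at s within I)) \<and>
        (\<forall>s\<in>I. \<exists>x y. (x \<noteq> 0 \<or> y \<noteq> 0) \<and> x *\<^sub>R n s + y *\<^sub>R b' (\<phi> s) = 0) \<and>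
        (\<forall>s\<in>I. line_through (\<alpha> s) (n s) = line_through (\<beta> (\<phi> s)) (b' (\<phi> s))) \<and>
        smooth_on_interval I lam \<and>
        (\<forall>s\<in>I. \<beta> (\<phi> s) = \<alpha> s + lam s *\<^sub>R n s))"

end

theory Submission
  imports Defs
begin

text \<open>
  Suppose first that \<open>\<beta> \<circ> \<phi> = \<alpha> + \<lambda> n\<close> for a partner \<open>\<beta>\<close> with frame \<open>t\<^sup>*, n\<^sup>*, b\<^sup>*\<close>. The Frenet
  equations give
  \<open>\<phi>' t\<^sup>* = (1 - \<lambda> k) t + \<lambda>' n + \<lambda> r b\<close>.
  Since \<open>n\<close> is parallel to \<open>b\<^sup>*\<close>, it is orthogonal to \<open>t\<^sup>*\<close>, so \<open>\<lambda>' = 0\<close> and \<open>\<lambda>\<close> is constant on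
  the interval. The direction of \<open>n\<^sup>*\<close> is that of \<open>(b\<^sup>*)'\<close>, hence that of \<open>n' = - k t + r b\<close>, and
  orthogonality of \<open>t\<^sup>*\<close> and \<open>n\<^sup>*\<close> becomes \<open>(1 - \<lambda> k) k = \<lambda> r\<^sup>2\<close>, which is the asserted relation
  (\<open>mannheim_offset_constant_and_curvature_relation\<close>).

  Conversely, let \<open>k = \<lambda> (k\<^sup>2 + r\<^sup>2)\<close>. The curve \<open>\<alpha> + \<lambda> n\<close> then has derivative
  \<open>(1 - \<lambda> k) t + \<lambda> r b\<close>, whose length \<open>v\<close> satisfies \<open>v\<^sup>2 = 1 - \<lambda> k = r\<^sup>2 / (k\<^sup>2 + r\<^sup>2) > 0\<close>
  (\<open>mannheim_direction\<close>). Its unit tangent is \<open>v t + w b\<close> with \<open>w = \<lambda> r / v\<close>, and the relation says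
  precisely that \<open>v k = w r\<close>. This is the condition under which rotating the frame in the plane of
  \<open>t\<close> and \<open>b\<close> by the angle with cosine \<open>v\<close> and sine \<open>w\<close> gives again a Frenet frame, with \<open>n\<close> as
  binormal (\<open>rotated_frenet_frame\<close>). It remains to introduce the arc length of \<open>\<alpha> + \<lambda> n\<close> as a
  parameter (\<open>frenet_curve_of_speed\<close>); the new curvature may vanish, but the new torsion is a
  nonzero multiple of \<open>w k + v r\<close>, which vanishes nowhere because \<open>n'\<close> does not.

  Smoothness on an interval that may contain its end points is given by a sequence of one-sided
  derivatives. It amounts to being differentiable any finite number of times, because one-sided
  derivatives on a nondegenerate interval are unique; closure under sums, products and powers is
  then an induction on the number of derivatives.
\<close>

section \<open>Calculus on intervals\<close>

lemma real_interval_at_within_neq_bot: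
  assumes "real_interval I" "s \<in> I"
  shows "at s within I \<noteq> bot"
proof -
  have "connected I" "interior I \<noteq> {}"
    using assms(1) by (auto simp: real_interval_def is_interval_connected_1)
  moreover have "I \<noteq> {x}" for x
    using \<open>interior I \<noteq> {}\<close> by auto
  ultimately show ?thesis
    using connected_imp_perfect[of I s] assms(2) by (simp add: trivial_limit_within)
qed

lemma derivative_within_real_interval_unique:
  assumes "real_interval I" "s \<in> I"
    and "(f has_vector_derivative D) (at s within I)"
    and "(f has_vector_derivative E) (at s within I)"
  shows "D = E"
  using vector_derivative_unique_within[OF real_interval_at_within_neq_bot] assms by blast

text \<open>
  The interval need not be closed and the function need not extend continuously to its closure, so
  the antiderivative is an integral from a fixed base point \<open>c\<close>. To differentiate it at \<open>s\<close>, the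
  fundamental theorem is applied on a compact subinterval that contains \<open>c\<close> and a neighbourhood of
  \<open>s\<close> relative to the interval.
\<close>

lemma continuous_has_antiderivative_on_interval:
  fixes f :: "real \<Rightarrow> real"
  assumes I: "is_interval I" and f: "continuous_on I f"
  shows "\<exists>F. \<forall>s\<in>I. (F has_vector_derivative f s) (at s within I)"
proof (cases "I = {}")
  case False
  then obtain c where c: "c \<in> I" by blast
  have "((\<lambda>u. LBINT y=c..u. f y) has_vector_derivative f s) (at s within I)" if s: "s \<in> I" for s
  proof -
    obtain a U where a: "a \<in> I" "a \<le> s" "a \<le> c" and U: "open U" "s \<in> U" "U \<inter> I \<subseteq> {a..}"
    proof (cases "\<exists>y\<in>I. y < s")
      case True
      then obtain y where y: "y \<in> I" "y < s" by blast
      show ?thesis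
      proof (rule that)
        show "min y c \<in> I" "min y c \<le> s" "min y c \<le> c" "open {y<..}" "s \<in> {y<..}"
          using y c by (simp_all add: min_def)
        show "{y<..} \<inter> I \<subseteq> {min y c..}"
          by (simp add: subset_iff min_le_iff_disj)
      qed
    next
      case False
      show ?thesis
      proof (rule that)
        show "UNIV \<inter> I \<subseteq> {s..}" "s \<le> c"
          using False c by (simp_all add: subset_iff not_less)
      qed (use s in simp_all)
    qed
    obtain b V where b: "b \<in> I" "s \<le> b" "c \<le> b" and V: "open V" "s \<in> V" "V \<inter> I \<subseteq> {..b}"
    proof (cases "\<exists>y\<in>I. s < y")
      case True
      then obtain y where y: "y \<in> I" "s < y" by blast
      show ?thesis
      proof (rule that)
        show "max y c \<in> I" "s \<le> max y c" "c \<le> max y c" "open {..<y}" "s \<in> {..<y}"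
          using y c by (simp_all add: max_def)
        show "{..<y} \<inter> I \<subseteq> {..max y c}"
          by (simp add: subset_iff le_max_iff_disj)
      qed
    next
      case False
      show ?thesis
      proof (rule that)
        show "UNIV \<inter> I \<subseteq> {..s}" "c \<le> s"
          using False c by (simp_all add: subset_iff not_less)
      qed (use s in simp_all)
    qed
    have sub: "{a..b} \<subseteq> I"
      using I a(1) b(1) by (simp add: is_interval_connected_1 connected_contains_Icc)
    have "((\<lambda>u. LBINT y=c..u. f y) has_vector_derivative f s) (at s within {a..b})"
      by (rule interval_integral_FTC2[OF a(3) b(3) continuous_on_subset[OF f sub] a(2) b(2)])
    moreover have "at s within {a..b} = at s within I"
    proof (rule at_within_nhd)
      have "I \<inter> (U \<inter> V) \<subseteq> {a..} \<inter> {..b}"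
        using U(3) V(3) by blast
      also have "\<dots> = {a..b}"
        by auto
      finally show "{a..b} \<inter> (U \<inter> V) - {s} = I \<inter> (U \<inter> V) - {s}"
        using sub by blast
    qed (use U(1,2) V(1,2) in auto)
    ultimately show ?thesis by (simp only:)
  qed
  then show ?thesis
    by blast
qed simp

section \<open>Smooth functions on an interval\<close>

text \<open>
  Smoothness is coinductive: a class of functions is smooth as soon as each member has a derivative
  in the class. The sequence of derivatives is found by dependent choice.
\<close>

lemma smooth_on_interval_coinduct:
  assumes "P f" and step: "\<And>g. P g \<Longrightarrow> \<exists>g'. (\<forall>s\<in>I. (g has_vector_derivative g' s) (at s within I)) \<and> P g'"
  shows "smooth_on_interval I f"
proof -
  have "\<exists>F. \<forall>m. (P (F m) \<and> (m = 0 \<longrightarrow> F m = f)) \<and>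
      (\<forall>s\<in>I. (F m has_vector_derivative F (Suc m) s) (at s within I))"
  proof (rule dependent_nat_choice)
    show "\<exists>y. (P y \<and> (Suc m = 0 \<longrightarrow> y = f)) \<and>
        (\<forall>s\<in>I. (g has_vector_derivative y s) (at s within I))"
      if "P g \<and> (m = 0 \<longrightarrow> g = f)" for g m
      using step[of g] that by simp blast
  qed (use assms(1) in simp)
  then obtain F where "F 0 = f"
    "\<forall>m. \<forall>s\<in>I. (F m has_vector_derivative F (Suc m) s) (at s within I)"
    by blast
  then show ?thesis
    unfolding smooth_on_interval_def by blast
qed

lemma smooth_on_interval_derivativeE:
  assumes "smooth_on_interval I f"
  obtains f' where "\<And>s. s \<in> I \<Longrightarrow> (f has_vector_derivative f' s) (at s within I)"
    and "smooth_on_interval I f'"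
proof -
  obtain F where F: "\<forall>s\<in>I. F 0 s = f s"
      "\<forall>m. \<forall>s\<in>I. (F m has_vector_derivative F (Suc m) s) (at s within I)"
    using assms unfolding smooth_on_interval_def by blast
  show ?thesis
  proof (rule that)
    show "(f has_vector_derivative F 1 s) (at s within I)" if "s \<in> I" for s
      by (rule has_vector_derivative_transform[of s I f "F 0"]) (use F that in simp_all)
    show "smooth_on_interval I (F 1)"
      unfolding smooth_on_interval_def using F(2) by (intro exI[of _ "\<lambda>m. F (Suc m)"]) simp
  qed
qed

lemma smooth_on_interval_cong:
  assumes "smooth_on_interval I f" "\<And>s. s \<in> I \<Longrightarrow> g s = f s"
  shows "smooth_on_interval I g"
proof -
  obtain F where "\<forall>s\<in>I. F 0 s = f s"
      "\<forall>m. \<forall>s\<in>I. (F m has_vector_derivative F (Suc m) s) (at s within I)"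
    using assms(1) unfolding smooth_on_interval_def by blast
  with assms(2) show ?thesis
    unfolding smooth_on_interval_def by (intro exI[of _ F]) simp
qed

lemma smooth_on_interval_derivative:
  assumes I: "real_interval I" and f: "smooth_on_interval I f"
    and der: "\<And>s. s \<in> I \<Longrightarrow> (f has_vector_derivative f' s) (at s within I)"
  shows "smooth_on_interval I f'"
proof -
  obtain g where g: "\<And>s. s \<in> I \<Longrightarrow> (f has_vector_derivative g s) (at s within I)"
      "smooth_on_interval I g"
    using smooth_on_interval_derivativeE[OF f] by blast
  show ?thesis
    using derivative_within_real_interval_unique[OF I _ der g(1)]
    by (intro smooth_on_interval_cong[OF g(2)]) blast
qed

lemma smooth_on_interval_antiderivative:
  assumes "smooth_on_interval I f'"
    and der: "\<And>s. s \<in> I \<Longrightarrow> (f has_vector_derivative f' s) (at s within I)"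
  shows "smooth_on_interval I f"
proof (rule smooth_on_interval_coinduct[where P = "\<lambda>g. g = f \<or> smooth_on_interval I g"])
  fix g assume "g = f \<or> smooth_on_interval I g"
  then show "\<exists>g'. (\<forall>s\<in>I. (g has_vector_derivative g' s) (at s within I)) \<and>
      (g' = f \<or> smooth_on_interval I g')"
  proof
    assume "smooth_on_interval I g"
    then show ?thesis
      by (rule smooth_on_interval_derivativeE) blast
  next
    assume "g = f"
    then show ?thesis
      using assms by (intro exI[of _ f']) simp
  qed
qed simp

lemma smooth_on_interval_const: "smooth_on_interval I (\<lambda>_. c)"
proof (rule smooth_on_interval_coinduct[where P = "\<lambda>g. \<exists>c. g = (\<lambda>_. c)"])
  fix g :: "real \<Rightarrow> 'a" assume "\<exists>c. g = (\<lambda>_. c)"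
  then show "\<exists>g'. (\<forall>s\<in>I. (g has_vector_derivative g' s) (at s within I)) \<and> (\<exists>c. g' = (\<lambda>_. c))"
    by (intro exI[of _ "\<lambda>_. 0"]) auto
qed (rule exI, rule refl)

text \<open>
  Closure properties of smooth functions are proved by induction on the number of derivatives, for
  which finite orders of differentiability are needed.
\<close>

primrec times_differentiable_on :: "nat \<Rightarrow> real set \<Rightarrow> (real \<Rightarrow> 'a::real_normed_vector) \<Rightarrow> bool" where
  "times_differentiable_on 0 I f \<longleftrightarrow> True"
| "times_differentiable_on (Suc m) I f \<longleftrightarrow>
     (\<exists>f'. (\<forall>s\<in>I. (f has_vector_derivative f' s) (at s within I)) \<and> times_differentiable_on m I f')"

lemma times_differentiable_on_Suc_imp:
  "times_differentiable_on (Suc m) I f \<Longrightarrow> times_differentiable_on m I f"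
  by (induction m arbitrary: f) auto

lemma times_differentiable_on_cong:
  assumes "times_differentiable_on m I f" "\<And>s. s \<in> I \<Longrightarrow> g s = f s"
  shows "times_differentiable_on m I g"
  using assms by (cases m) (auto intro: has_vector_derivative_transform)

lemma smooth_imp_times_differentiable_on:
  "smooth_on_interval I f \<Longrightarrow> times_differentiable_on m I f"
proof (induction m arbitrary: f)
  case (Suc m)
  show ?case
    by (rule smooth_on_interval_derivativeE[OF Suc.prems]) (use Suc.IH in auto)
qed simp

text \<open>
  Derivatives of different finite orders fit together into one sequence because on a nondegenerate
  interval the derivative is determined by the function.
\<close>

lemma smooth_on_interval_iff:
  assumes "real_interval I"
  shows "smooth_on_interval I f \<longleftrightarrow> (\<forall>m. times_differentiable_on m I f)"
proof
  assume "\<forall>m. times_differentiable_on m I f"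
  then show "smooth_on_interval I f"
  proof (rule smooth_on_interval_coinduct[where P = "\<lambda>g. \<forall>m. times_differentiable_on m I g"])
    fix g :: "real \<Rightarrow> 'a" assume g: "\<forall>m. times_differentiable_on m I g"
    then have "\<forall>m. times_differentiable_on (Suc m) I g" by blast
    then have *: "\<exists>h. (\<forall>s\<in>I. (g has_vector_derivative h s) (at s within I)) \<and>
        times_differentiable_on m I h" for m
      by simp
    obtain g' where g': "\<forall>s\<in>I. (g has_vector_derivative g' s) (at s within I)"
      using *[of 0] by blast
    have "times_differentiable_on m I g'" for m
    proof -
      obtain h where "\<forall>s\<in>I. (g has_vector_derivative h s) (at s within I)"
        "times_differentiable_on m I h"
        using *[of m] by blast
      then show ?thesis
        using derivative_within_real_interval_unique[OF assms] g'
        by (blast intro: times_differentiable_on_cong[of m I h])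
    qed
    with g' show "\<exists>g'. (\<forall>s\<in>I. (g has_vector_derivative g' s) (at s within I)) \<and>
        (\<forall>m. times_differentiable_on m I g')"
      by blast
  qed
qed (simp add: smooth_imp_times_differentiable_on)

lemma times_differentiable_on_add:
  assumes "times_differentiable_on m I f" "times_differentiable_on m I g"
  shows "times_differentiable_on m I (\<lambda>s. f s + g s)"
  using assms
proof (induction m arbitrary: f g)
  case (Suc m)
  then obtain f' g' where "\<forall>s\<in>I. (f has_vector_derivative f' s) (at s within I)"
      "times_differentiable_on m I f'"
      "\<forall>s\<in>I. (g has_vector_derivative g' s) (at s within I)" "times_differentiable_on m I g'"
    by auto
  then show ?case
    unfolding times_differentiable_on.simps
    by (intro exI[of _ "\<lambda>s. f' s + g' s"] conjI ballI has_vector_derivative_add Suc.IH) auto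
qed simp

lemma (in bounded_bilinear) times_differentiable_on_prod:
  assumes "times_differentiable_on m I f" "times_differentiable_on m I g"
  shows "times_differentiable_on m I (\<lambda>s. prod (f s) (g s))"
  using assms
proof (induction m arbitrary: f g)
  case (Suc m)
  then obtain f' g' where "\<forall>s\<in>I. (f has_vector_derivative f' s) (at s within I)"
      "times_differentiable_on m I f'"
      "\<forall>s\<in>I. (g has_vector_derivative g' s) (at s within I)" "times_differentiable_on m I g'"
    by auto
  moreover note Suc.prems[THEN times_differentiable_on_Suc_imp]
  ultimately show ?case
    unfolding times_differentiable_on.simps
    by (intro exI[of _ "\<lambda>s. prod (f s) (g' s) + prod (f' s) (g s)"] conjI ballI
        has_vector_derivative times_differentiable_on_add Suc.IH) auto
qed simp

lemma has_vector_derivative_powr_within: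
  fixes f :: "real \<Rightarrow> real"
  assumes "(f has_vector_derivative f') (at s within I)" "f s > 0"
  shows "((\<lambda>s. f s powr p) has_vector_derivative p * f s powr (p - 1) * f') (at s within I)"
proof -
  have "((\<lambda>s. f s powr p) has_real_derivative p * f s powr (p - 1) * f') (at s within I)"
    using assms(1)[folded has_real_derivative_iff_has_vector_derivative] assms(2)
    by (intro DERIV_chain2[where f = "\<lambda>z. z powr p" and g = f, OF has_real_derivative_powr])
  then show ?thesis
    by (simp add: has_real_derivative_iff_has_vector_derivative)
qed

lemma times_differentiable_on_const: "times_differentiable_on m I (\<lambda>_. c)"
  by (simp add: smooth_imp_times_differentiable_on smooth_on_interval_const)

text \<open>
  The derivative of \<open>f powr p\<close> is \<open>p * f powr (p - 1) * f'\<close>, so the induction has to treat all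
  exponents at once. Reciprocals and square roots are the cases \<open>p = -1\<close> and \<open>p = 1/2\<close>.
\<close>

lemma times_differentiable_on_powr:
  fixes f :: "real \<Rightarrow> real"
  assumes "times_differentiable_on m I f" and pos: "\<And>s. s \<in> I \<Longrightarrow> f s > 0"
  shows "times_differentiable_on m I (\<lambda>s. f s powr p)"
  using assms(1)
proof (induction m arbitrary: p)
  note mult = bounded_bilinear.times_differentiable_on_prod[OF bounded_bilinear_mult]
  case (Suc m)
  then obtain f' where f': "\<forall>s\<in>I. (f has_vector_derivative f' s) (at s within I)"
      "times_differentiable_on m I f'"
    by auto
  have "times_differentiable_on m I (\<lambda>s. f s powr (p - 1))"
    by (rule Suc.IH[OF times_differentiable_on_Suc_imp[OF Suc.prems]])
  then have "times_differentiable_on m I (\<lambda>s. p * f s powr (p - 1) * f' s)"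
    by (rule mult[OF mult[OF times_differentiable_on_const] f'(2)])
  moreover have "\<forall>s\<in>I. ((\<lambda>s. f s powr p) has_vector_derivative p * f s powr (p - 1) * f' s) (at s within I)"
    using f'(1) pos by (simp add: has_vector_derivative_powr_within)
  ultimately show ?case
    unfolding times_differentiable_on.simps
    by (intro exI[of _ "\<lambda>s. p * f s powr (p - 1) * f' s"] conjI)
qed simp

context
  fixes I :: "real set"
  assumes I: "real_interval I"
begin

lemma smooth_on_interval_add:
  "smooth_on_interval I f \<Longrightarrow> smooth_on_interval I g \<Longrightarrow> smooth_on_interval I (\<lambda>s. f s + g s)"
  by (simp add: smooth_on_interval_iff[OF I] times_differentiable_on_add)

lemma smooth_on_interval_scaleR:
  "smooth_on_interval I f \<Longrightarrow> smooth_on_interval I g \<Longrightarrow> smooth_on_interval I (\<lambda>s. f s *\<^sub>R g s)"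
  by (simp add: smooth_on_interval_iff[OF I]
      bounded_bilinear.times_differentiable_on_prod[OF bounded_bilinear_scaleR])

lemma smooth_on_interval_mult:
  fixes f g :: "real \<Rightarrow> real"
  shows "smooth_on_interval I f \<Longrightarrow> smooth_on_interval I g \<Longrightarrow> smooth_on_interval I (\<lambda>s. f s * g s)"
  using smooth_on_interval_scaleR[of f g] by simp

lemma smooth_on_interval_inner:
  "smooth_on_interval I f \<Longrightarrow> smooth_on_interval I g \<Longrightarrow> smooth_on_interval I (\<lambda>s. f s \<bullet> g s)"
  by (simp add: smooth_on_interval_iff[OF I]
      bounded_bilinear.times_differentiable_on_prod[OF bounded_bilinear_inner])

lemma smooth_on_interval_inverse:
  fixes f :: "real \<Rightarrow> real"
  assumes f: "smooth_on_interval I f" and pos: "\<And>s. s \<in> I \<Longrightarrow> f s > 0"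
  shows "smooth_on_interval I (\<lambda>s. inverse (f s))"
proof (rule smooth_on_interval_cong)
  show "smooth_on_interval I (\<lambda>s. f s powr (- 1))"
    using f pos unfolding smooth_on_interval_iff[OF I] by (blast intro: times_differentiable_on_powr)
  show "inverse (f s) = f s powr (- 1)" if "s \<in> I" for s
    using pos[OF that] by (simp add: powr_minus)
qed

lemma smooth_on_interval_sqrt:
  assumes f: "smooth_on_interval I f" and pos: "\<And>s. s \<in> I \<Longrightarrow> f s > 0"
  shows "smooth_on_interval I (\<lambda>s. sqrt (f s))"
proof (rule smooth_on_interval_cong)
  show "smooth_on_interval I (\<lambda>s. f s powr (1 / 2))"
    using f pos unfolding smooth_on_interval_iff[OF I] by (blast intro: times_differentiable_on_powr)
  show "sqrt (f s) = f s powr (1 / 2)" if "s \<in> I" for s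
    using pos[OF that] by (simp add: powr_half_sqrt)
qed

end

section \<open>Reparametrization\<close>

lemma antiderivative_of_positive_less:
  fixes \<phi> v :: "real \<Rightarrow> real"
  assumes I: "is_interval I" and pos: "\<And>s. s \<in> I \<Longrightarrow> v s > 0"
    and der: "\<And>s. s \<in> I \<Longrightarrow> (\<phi> has_vector_derivative v s) (at s within I)"
    and "x \<in> I" "y \<in> I" "x < y"
  shows "\<phi> x < \<phi> y"
proof -
  have sub: "{x..y} \<subseteq> I"
    using I assms(4,5) by (simp add: is_interval_connected_1 connected_contains_Icc)
  have "\<exists>z\<in>{x<..<y}. \<phi> y - \<phi> x = (y - x) *\<^sub>R v z"
  proof (rule mvt_simple[OF \<open>x < y\<close>])
    fix z assume "x \<le> z" "z \<le> y"
    then have "(\<phi> has_vector_derivative v z) (at z within {x..y})"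
      using sub by (intro has_vector_derivative_within_subset[OF der sub]) auto
    then show "(\<phi> has_derivative (\<lambda>h. h *\<^sub>R v z)) (at z within {x..y})"
      by (simp add: has_vector_derivative_def)
  qed
  then obtain z where z: "z \<in> {x<..<y}" "\<phi> y - \<phi> x = (y - x) * v z"
    by auto
  moreover have "v z > 0"
    using z(1) sub by (intro pos) (auto simp: subset_iff)
  ultimately have "\<phi> y - \<phi> x > 0"
    using \<open>x < y\<close> by simp
  then show ?thesis by simp
qed

lemma real_interval_image_inj:
  assumes I: "real_interval I" and \<phi>: "continuous_on I \<phi>" "inj_on \<phi> I"
  shows "real_interval (\<phi> ` I)"
proof -
  have conn: "connected (\<phi> ` I)"
    using I \<phi>(1) by (auto simp: real_interval_def is_interval_connected_1
        intro: connected_continuous_image)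
  obtain x where x: "x \<in> interior I"
    using I by (auto simp: real_interval_def)
  then obtain y where y: "y \<in> I" "y \<noteq> x"
    using interior_subset by (cases "I = {x}") auto
  have "\<phi> x \<in> \<phi> ` I" "\<phi> y \<in> \<phi> ` I" "\<phi> x \<noteq> \<phi> y"
    using x y \<phi>(2) interior_subset by (auto dest: inj_onD)
  then obtain a b where ab: "a \<in> \<phi> ` I" "b \<in> \<phi> ` I" "a < b"
    by (metis (lifting) linorder_neqE_linordered_idom)
  have "{a<..<b} \<subseteq> \<phi> ` I"
    using connected_contains_Icc[OF conn ab(1,2)] greaterThanLessThan_subseteq_atLeastAtMost_iff
    by blast
  then have "{a<..<b} \<subseteq> interior (\<phi> ` I)"
    by (simp add: interior_maximal)
  then have "interior (\<phi> ` I) \<noteq> {}"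
    using dense[OF \<open>a < b\<close>] by auto
  with conn show ?thesis
    by (simp add: real_interval_def is_interval_connected_1)
qed

text \<open>
  For a curve of speed \<open>v\<close>, the function \<open>\<phi>\<close> is its arc length and \<open>\<psi>\<close> is the old parameter as a
  function of arc length.
\<close>

lemma reparametrization_with_speed:
  fixes v :: "real \<Rightarrow> real"
  assumes I: "real_interval I" and v: "smooth_on_interval I v" "\<And>s. s \<in> I \<Longrightarrow> v s > 0"
  obtains \<phi> \<psi> where "smooth_on_interval I \<phi>"
    and "\<And>s. s \<in> I \<Longrightarrow> (\<phi> has_vector_derivative v s) (at s within I)"
    and "real_interval (\<phi> ` I)"
    and "\<And>s. s \<in> I \<Longrightarrow> \<psi> (\<phi> s) = s"
    and "\<And>s. s \<in> I \<Longrightarrow> (\<psi> has_vector_derivative inverse (v s)) (at (\<phi> s) within \<phi> ` I)"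
proof -
  have ivl: "is_interval I"
    using I by (simp add: real_interval_def)
  obtain v' where v': "\<And>s. s \<in> I \<Longrightarrow> (v has_vector_derivative v' s) (at s within I)"
    using smooth_on_interval_derivativeE[OF v(1)] by blast
  have "continuous_on I v"
    using v' by (meson continuous_on_eq_continuous_within has_vector_derivative_continuous)
  then obtain \<phi> where \<phi>: "\<And>s. s \<in> I \<Longrightarrow> (\<phi> has_vector_derivative v s) (at s within I)"
    using continuous_has_antiderivative_on_interval[OF ivl] by blast
  have cont: "continuous_on I \<phi>"
    using \<phi> by (meson continuous_on_eq_continuous_within has_vector_derivative_continuous)
  have inj: "inj_on \<phi> I"
    using antiderivative_of_positive_less[OF ivl v(2) \<phi>]
    by (metis inj_onI less_irrefl linorder_neqE_linordered_idom)
  have "path_connected I"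
    using ivl by (simp add: is_interval_path_connected_1)
  then obtain \<psi> where hom: "homeomorphism I (\<phi> ` I) \<phi> \<psi>"
    using homeomorphism_into_1d cont inj by blast
  have \<psi>: "\<psi> (\<phi> s) = s" if "s \<in> I" for s
    using hom that by (simp add: homeomorphism_def)
  have "(\<psi> has_vector_derivative inverse (v s)) (at (\<phi> s) within \<phi> ` I)" if s: "s \<in> I" for s
  proof -
    have "continuous (at (\<phi> s) within \<phi> ` I) \<psi>"
      using hom s by (auto simp: homeomorphism_def continuous_on_eq_continuous_within)
    then show ?thesis
      unfolding has_vector_derivative_def
      by (rule has_derivative_inverse_within[OF \<phi>[OF s, unfolded has_vector_derivative_def]])
        (use s v(2)[OF s] \<psi> in \<open>auto simp: o_def fun_eq_iff intro!: linearI simp: algebra_simps\<close>)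
  qed
  then show thesis
    using that \<phi> \<psi> real_interval_image_inj[OF I cont inj]
      smooth_on_interval_antiderivative[OF v(1) \<phi>] by blast
qed

lemma has_vector_derivative_reparametrized:
  assumes "(\<psi> has_vector_derivative c) (at (\<phi> s) within \<phi> ` I)"
    and "\<And>s. s \<in> I \<Longrightarrow> \<psi> (\<phi> s) = s" "s \<in> I"
    and "(g has_vector_derivative g') (at s within I)"
  shows "((\<lambda>u. g (\<psi> u)) has_vector_derivative c *\<^sub>R g') (at (\<phi> s) within \<phi> ` I)"
proof -
  have "\<psi> ` \<phi> ` I = I"
    using assms(2) by force
  then show ?thesis
    using vector_diff_chain_within[OF assms(1), of g g'] assms by (simp add: o_def)
qed

text \<open>
  The derivative of \<open>g \<circ> \<psi>\<close> is \<open>(p *\<^sub>R g') \<circ> \<psi>\<close>, again a smooth function on \<open>I\<close> composed with \<open>\<psi>\<close>.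
  The functions of this form are therefore closed under differentiation, and coinduction applies.
\<close>

lemma smooth_on_interval_reparametrized:
  fixes p :: "real \<Rightarrow> real"
  assumes I: "real_interval I" and p: "smooth_on_interval I p"
    and \<psi>: "\<And>s. s \<in> I \<Longrightarrow> \<psi> (\<phi> s) = s"
      "\<And>s. s \<in> I \<Longrightarrow> (\<psi> has_vector_derivative p s) (at (\<phi> s) within \<phi> ` I)"
    and g: "smooth_on_interval I g"
  shows "smooth_on_interval (\<phi> ` I) (\<lambda>u. g (\<psi> u))"
proof (rule smooth_on_interval_coinduct[where
      P = "\<lambda>h. \<exists>g. smooth_on_interval I g \<and> h = (\<lambda>u. g (\<psi> u))"])
  fix h :: "real \<Rightarrow> 'a"
  assume "\<exists>g. smooth_on_interval I g \<and> h = (\<lambda>u. g (\<psi> u))"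
  then obtain g where g: "smooth_on_interval I g" "h = (\<lambda>u. g (\<psi> u))"
    by blast
  obtain g' where g': "\<And>s. s \<in> I \<Longrightarrow> (g has_vector_derivative g' s) (at s within I)"
    "smooth_on_interval I g'"
    using smooth_on_interval_derivativeE[OF g(1)] by blast
  have "(h has_vector_derivative p (\<psi> u) *\<^sub>R g' (\<psi> u)) (at u within \<phi> ` I)" if "u \<in> \<phi> ` I" for u
    using that has_vector_derivative_reparametrized[OF \<psi>(2) \<psi>(1) _ g'(1)] \<psi>(1)
    by (auto simp: g(2))
  moreover have "smooth_on_interval I (\<lambda>s. p s *\<^sub>R g' s)"
    by (intro smooth_on_interval_scaleR[OF I] p g')
  ultimately show "\<exists>h'. (\<forall>u\<in>\<phi> ` I. (h has_vector_derivative h' u) (at u within \<phi> ` I)) \<and>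
      (\<exists>g. smooth_on_interval I g \<and> h' = (\<lambda>u. g (\<psi> u)))"
    by (intro exI[of _ "\<lambda>u. p (\<psi> u) *\<^sub>R g' (\<psi> u)"] conjI ballI exI[of _ "\<lambda>s. p s *\<^sub>R g' s"]) auto
qed (use g in blast)

section \<open>Frenet curves of spatial quaternions\<close>

lemma quat_of_real_eq_iff [simp]: "quat_of_real x = quat_of_real y \<longleftrightarrow> x = y"
  by (metis quat_of_real_def vector_4(4))

lemma quat_of_real_eq_0_iff [simp]: "quat_of_real x = 0 \<longleftrightarrow> x = 0"
  using quat_of_real_eq_iff[of x 0] by (simp add: vec_eq_iff forall_4 quat_defs)

lemma quat_orthonormal_iff:
  "quat_orthonormal u v w \<longleftrightarrow>
     u \<bullet> u = 1 \<and> v \<bullet> v = 1 \<and> w \<bullet> w = 1 \<and> u \<bullet> v = 0 \<and> u \<bullet> w = 0 \<and> v \<bullet> w = 0"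
  by (simp add: quat_orthonormal_def quat_h_inner)

lemma quat_frenet_curveD:
  assumes "quat_frenet_curve I \<alpha> t n b k r" "s \<in> I"
  shows "t s \<bullet> t s = 1" "n s \<bullet> n s = 1" "b s \<bullet> b s = 1"
    "t s \<bullet> n s = 0" "t s \<bullet> b s = 0" "n s \<bullet> b s = 0"
    "n s \<bullet> t s = 0" "b s \<bullet> t s = 0" "b s \<bullet> n s = 0"
    and "(\<alpha> has_vector_derivative t s) (at s within I)"
    "(t has_vector_derivative k s *\<^sub>R n s) (at s within I)"
    "(n has_vector_derivative - (k s *\<^sub>R t s) + r s *\<^sub>R b s) (at s within I)"
    "(b has_vector_derivative - (r s *\<^sub>R n s)) (at s within I)"
  using assms by (simp_all add: quat_frenet_curve_def quat_orthonormal_iff inner_commute)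

lemma quat_frenet_curve_interval: "quat_frenet_curve I \<alpha> t n b k r \<Longrightarrow> real_interval I"
  by (simp add: quat_frenet_curve_def)

text \<open>
  The curvatures are recovered from the smooth frame as \<open>k = t' \<bullet> n\<close> and \<open>r = n' \<bullet> b\<close>.
\<close>

lemma quat_frenet_curve_smooth_curvatures:
  assumes "quat_frenet_curve I \<alpha> t n b k r"
  shows "smooth_on_interval I k" "smooth_on_interval I r"
proof -
  note I = quat_frenet_curve_interval[OF assms]
  note d = quat_frenet_curveD[OF assms]
  have sm: "smooth_on_interval I t" "smooth_on_interval I n" "smooth_on_interval I b"
    using assms by (simp_all add: quat_frenet_curve_def)
  have "smooth_on_interval I (\<lambda>s. (k s *\<^sub>R n s) \<bullet> n s)"
    by (intro smooth_on_interval_inner[OF I] smooth_on_interval_derivative[OF I sm(1)] d sm)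
  then show "smooth_on_interval I k"
    by (rule smooth_on_interval_cong) (simp add: d)
  have "smooth_on_interval I (\<lambda>s. (- (k s *\<^sub>R t s) + r s *\<^sub>R b s) \<bullet> b s)"
    by (intro smooth_on_interval_inner[OF I] smooth_on_interval_derivative[OF I sm(2)] d sm)
  then show "smooth_on_interval I r"
    by (rule smooth_on_interval_cong) (simp add: d inner_simps)
qed

section \<open>Mannheim curves satisfy the curvature relation\<close>

lemma inner_eq_0_derivative:
  assumes I: "real_interval I" "s \<in> I" and "\<And>s. s \<in> I \<Longrightarrow> f s \<bullet> g s = 0"
    and "(f has_vector_derivative f') (at s within I)" "(g has_vector_derivative g') (at s within I)"
  shows "f s \<bullet> g' + f' \<bullet> g s = 0"
proof (rule derivative_within_real_interval_unique[OF I])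
  show "((\<lambda>s. f s \<bullet> g s) has_vector_derivative f s \<bullet> g' + f' \<bullet> g s) (at s within I)"
    by (rule bounded_bilinear.has_vector_derivative[OF bounded_bilinear_inner assms(4,5)])
  show "((\<lambda>s. f s \<bullet> g s) has_vector_derivative 0) (at s within I)"
    by (rule has_vector_derivative_transform[where f = "\<lambda>_. 0"]) (simp_all add: I assms(3))
qed

text \<open>
  Write \<open>b\<^sup>* = e n\<close> at the given point. Three inner products decide the matter: that of
  \<open>\<phi>' t\<^sup>* = (1 - \<lambda> k) t + \<lambda>' n + \<lambda> r b\<close> with \<open>n\<close> gives \<open>\<lambda>' = 0\<close>; differentiating
  \<open>b\<^sup>* \<bullet> t = 0\<close> and \<open>b\<^sup>* \<bullet> b = 0\<close> shows that the components of \<open>\<phi>' r\<^sup>* n\<^sup>*\<close> along \<open>t\<close> and \<open>b\<close> are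
  \<open>e k\<close> and \<open>- e r\<close>; and then \<open>t\<^sup>* \<bullet> n\<^sup>* = 0\<close> gives the relation. Differentiating these orthogonality
  relations instead of \<open>b\<^sup>* = e n\<close> leaves no derivative of \<open>e\<close> to be dealt with.
\<close>

lemma mannheim_offset_constant_and_curvature_relation:
  assumes \<alpha>: "quat_frenet_curve I \<alpha> t n b k r"
    and \<beta>: "quat_frenet_curve J \<beta> t' n' b' k' r'"
    and \<phi>: "\<phi> ` I = J" "\<And>s. s \<in> I \<Longrightarrow> (\<phi> has_vector_derivative v s) (at s within I)"
    and lam: "\<And>s. s \<in> I \<Longrightarrow> (lam has_vector_derivative lam' s) (at s within I)"
    and eq: "\<And>s. s \<in> I \<Longrightarrow> \<beta> (\<phi> s) = \<alpha> s + lam s *\<^sub>R n s"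
    and dep: "\<And>s. s \<in> I \<Longrightarrow> \<exists>x y. (x \<noteq> 0 \<or> y \<noteq> 0) \<and> x *\<^sub>R n s + y *\<^sub>R b' (\<phi> s) = 0"
    and s: "s \<in> I"
  shows "lam' s = 0" "k s = lam s * ((k s)\<^sup>2 + (r s)\<^sup>2)"
proof -
  note I = quat_frenet_curve_interval[OF \<alpha>]
  have J: "\<phi> s \<in> J" if "s \<in> I" for s
    using \<phi>(1) that by blast
  note a = quat_frenet_curveD[OF \<alpha>] and c = quat_frenet_curveD[OF \<beta> J]
  have par: "\<exists>e. e \<noteq> 0 \<and> b' (\<phi> s) = e *\<^sub>R n s" if s: "s \<in> I" for s
  proof -
    obtain x y where xy: "x \<noteq> 0 \<or> y \<noteq> 0" "x *\<^sub>R n s + y *\<^sub>R b' (\<phi> s) = 0"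
      using dep[OF s] by blast
    have ne: "n s \<noteq> 0" "b' (\<phi> s) \<noteq> 0"
      using a(2)[OF s] c(3)[OF s] by force+
    have "x \<noteq> 0" "y \<noteq> 0"
      using xy ne by auto
    moreover have "b' (\<phi> s) = - (x / y) *\<^sub>R n s"
    proof -
      have "y *\<^sub>R b' (\<phi> s) = (- x) *\<^sub>R n s"
        using xy(2) by (metis add.commute eq_neg_iff_add_eq_0 scaleR_minus_left)
      then have "(1 / y) *\<^sub>R (y *\<^sub>R b' (\<phi> s)) = (1 / y) *\<^sub>R ((- x) *\<^sub>R n s)"
        by simp
      then show ?thesis
        using \<open>y \<noteq> 0\<close> by simp
    qed
    ultimately show ?thesis
      by (intro exI[of _ "- (x / y)"]) simp
  qed
  obtain e where e: "e \<noteq> 0" "b' (\<phi> s) = e *\<^sub>R n s"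
    using par[OF s] by blast
  have \<beta>': "v s *\<^sub>R t' (\<phi> s) =
      (1 - lam s * k s) *\<^sub>R t s + lam' s *\<^sub>R n s + (lam s * r s) *\<^sub>R b s"
  proof (rule derivative_within_real_interval_unique[OF I s])
    have "(\<beta> has_vector_derivative t' (\<phi> s)) (at (\<phi> s) within \<phi> ` I)"
      using c(10)[OF s] \<phi>(1) by simp
    from vector_diff_chain_within[OF \<phi>(2)[OF s] this]
    show "((\<lambda>s. \<beta> (\<phi> s)) has_vector_derivative v s *\<^sub>R t' (\<phi> s)) (at s within I)"
      by (simp add: o_def)
    have "((\<lambda>s. \<alpha> s + lam s *\<^sub>R n s) has_vector_derivative
        t s + (lam s *\<^sub>R (- (k s *\<^sub>R t s) + r s *\<^sub>R b s) + lam' s *\<^sub>R n s)) (at s within I)"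
      by (intro has_vector_derivative_add has_vector_derivative_scaleR a(10,12)[OF s])
        (use lam[OF s] in \<open>simp add: has_real_derivative_iff_has_vector_derivative\<close>)
    then have "((\<lambda>s. \<beta> (\<phi> s)) has_vector_derivative
        t s + (lam s *\<^sub>R (- (k s *\<^sub>R t s) + r s *\<^sub>R b s) + lam' s *\<^sub>R n s)) (at s within I)"
      by (rule has_vector_derivative_transform[rotated 2]) (simp_all add: s eq)
    then show "((\<lambda>s. \<beta> (\<phi> s)) has_vector_derivative
        (1 - lam s * k s) *\<^sub>R t s + lam' s *\<^sub>R n s + (lam s * r s) *\<^sub>R b s) (at s within I)"
      by (simp add: algebra_simps)
  qed
  have "n s \<bullet> t' (\<phi> s) = 0" "n s \<bullet> n' (\<phi> s) = 0"
    using c(8,9)[OF s] e by auto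
  then have n: "t' (\<phi> s) \<bullet> n s = 0" "n s \<bullet> n' (\<phi> s) = 0"
    by (simp_all add: inner_commute)
  have "0 = (v s *\<^sub>R t' (\<phi> s)) \<bullet> n s"
    using n by simp
  also have "\<dots> = lam' s"
    by (simp add: \<beta>' inner_simps a s)
  finally show lam': "lam' s = 0" by simp
  have b': "((\<lambda>s. b' (\<phi> s)) has_vector_derivative v s *\<^sub>R - (r' (\<phi> s) *\<^sub>R n' (\<phi> s))) (at s within I)"
  proof -
    have "(b' has_vector_derivative - (r' (\<phi> s) *\<^sub>R n' (\<phi> s))) (at (\<phi> s) within \<phi> ` I)"
      using c(13)[OF s] \<phi>(1) by simp
    from vector_diff_chain_within[OF \<phi>(2)[OF s] this] show ?thesis
      by (simp add: o_def)
  qed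
  have perp: "b' (\<phi> s) \<bullet> t s = 0" "b' (\<phi> s) \<bullet> b s = 0" if "s \<in> I" for s
    using par[OF that] a[OF that] by auto
  have T: "v s * r' (\<phi> s) * (t s \<bullet> n' (\<phi> s)) = k s * e"
    using inner_eq_0_derivative[OF I s perp(1) b' a(11)[OF s]]
    by (simp add: e a s inner_commute)
  have B: "v s * r' (\<phi> s) * (b s \<bullet> n' (\<phi> s)) = - r s * e"
    using inner_eq_0_derivative[OF I s perp(2) b' a(13)[OF s]]
    by (simp add: e a s inner_commute)
  have "0 = (v s *\<^sub>R t' (\<phi> s)) \<bullet> n' (\<phi> s)"
    using c(4)[OF s] by simp
  also have "\<dots> = (1 - lam s * k s) * (t s \<bullet> n' (\<phi> s)) + lam s * r s * (b s \<bullet> n' (\<phi> s))"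
    by (simp add: \<beta>' inner_simps lam' n)
  finally have "0 = v s * r' (\<phi> s) *
      ((1 - lam s * k s) * (t s \<bullet> n' (\<phi> s)) + lam s * r s * (b s \<bullet> n' (\<phi> s)))"
    by simp
  also have "\<dots> = (1 - lam s * k s) * (v s * r' (\<phi> s) * (t s \<bullet> n' (\<phi> s))) +
      lam s * r s * (v s * r' (\<phi> s) * (b s \<bullet> n' (\<phi> s)))"
    by (simp add: algebra_simps)
  also have "\<dots> = e * (k s - lam s * ((k s)\<^sup>2 + (r s)\<^sup>2))"
    unfolding T B by (simp add: algebra_simps power2_eq_square)
  finally show "k s = lam s * ((k s)\<^sup>2 + (r s)\<^sup>2)"
    using e(1) by simp
qed

lemma mannheim_curve_imp_curvature_relation:
  assumes "mannheim_curve I \<alpha> t n b k r"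
  shows "\<exists>lam. \<forall>s\<in>I. k s = lam * ((k s)\<^sup>2 + (r s)\<^sup>2)"
proof -
  have \<alpha>: "quat_frenet_curve I \<alpha> t n b k r"
    using assms by (simp add: mannheim_curve_def spatial_quat_curve_def)
  obtain J \<beta> t' n' b' k' r' \<phi> lam where
    \<beta>: "quat_frenet_curve J \<beta> t' n' b' k' r'" and bij: "bij_betw \<phi> I J"
    and \<phi>: "\<forall>s\<in>I. \<exists>d. d \<noteq> 0 \<and> (\<phi> has_real_derivative d) (at s within I)"
    and dep: "\<forall>s\<in>I. \<exists>x y. (x \<noteq> 0 \<or> y \<noteq> 0) \<and> x *\<^sub>R n s + y *\<^sub>R b' (\<phi> s) = 0"
    and lam: "smooth_on_interval I lam"
    and eq: "\<forall>s\<in>I. \<beta> (\<phi> s) = \<alpha> s + lam s *\<^sub>R n s"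
    using assms unfolding mannheim_curve_def by blast
  obtain v where v: "\<And>s. s \<in> I \<Longrightarrow> (\<phi> has_vector_derivative v s) (at s within I)"
    using \<phi> unfolding has_real_derivative_iff_has_vector_derivative by metis
  obtain lam' where lam': "\<And>s. s \<in> I \<Longrightarrow> (lam has_vector_derivative lam' s) (at s within I)"
    using smooth_on_interval_derivativeE[OF lam] by blast
  have rel: "lam' s = 0" "k s = lam s * ((k s)\<^sup>2 + (r s)\<^sup>2)" if "s \<in> I" for s
    using mannheim_offset_constant_and_curvature_relation[OF \<alpha> \<beta> bij_betw_imp_surj_on[OF bij] v lam'
        bspec[OF eq] bspec[OF dep] that]
    by blast+
  have "convex I"
    using quat_frenet_curve_interval[OF \<alpha>] by (simp add: real_interval_def is_interval_convex)
  moreover have "(lam has_derivative (\<lambda>h. 0)) (at s within I)" if "s \<in> I" for s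
    using lam'[OF that] rel(1)[OF that] by (simp add: has_vector_derivative_def)
  ultimately obtain c where "\<forall>s\<in>I. lam s = c"
    using has_derivative_zero_constant by blast
  then show ?thesis
    using rel(2) by (intro exI[of _ c]) auto
qed

section \<open>Construction of a Mannheim partner\<close>

text \<open>
  Here \<open>v\<close> is the speed of \<open>\<beta>\<close>, and \<open>\<kappa>\<close> and \<open>\<tau>\<close> measure how fast the frame turns with respect to
  the given parameter. Passing to the arc length parameter divides all derivatives by \<open>v\<close>, which
  turns these rates into the curvatures.
\<close>

lemma frenet_curve_of_speed:
  assumes I: "real_interval I" and v: "smooth_on_interval I v" "\<And>s. s \<in> I \<Longrightarrow> v s > 0"
    and smooth: "smooth_on_interval I \<beta>" "smooth_on_interval I T" "smooth_on_interval I N"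
      "smooth_on_interval I B"
    and spatial: "\<And>s. s \<in> I \<Longrightarrow> {\<beta> s, T s, N s, B s} \<subseteq> spatial_quats"
    and orth: "\<And>s. s \<in> I \<Longrightarrow> quat_orthonormal (T s) (N s) (B s)"
    and der: "\<And>s. s \<in> I \<Longrightarrow> (\<beta> has_vector_derivative v s *\<^sub>R T s) (at s within I)"
      "\<And>s. s \<in> I \<Longrightarrow> (T has_vector_derivative \<kappa> s *\<^sub>R N s) (at s within I)"
      "\<And>s. s \<in> I \<Longrightarrow> (N has_vector_derivative - (\<kappa> s *\<^sub>R T s) + \<tau> s *\<^sub>R B s) (at s within I)"
      "\<And>s. s \<in> I \<Longrightarrow> (B has_vector_derivative - (\<tau> s *\<^sub>R N s)) (at s within I)"
  obtains \<phi> \<psi> where "smooth_on_interval I \<phi>"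
    and "\<And>s. s \<in> I \<Longrightarrow> (\<phi> has_vector_derivative v s) (at s within I)"
    and "\<And>s. s \<in> I \<Longrightarrow> \<psi> (\<phi> s) = s"
    and "quat_frenet_curve (\<phi> ` I) (\<lambda>u. \<beta> (\<psi> u)) (\<lambda>u. T (\<psi> u)) (\<lambda>u. N (\<psi> u)) (\<lambda>u. B (\<psi> u))
      (\<lambda>u. \<kappa> (\<psi> u) / v (\<psi> u)) (\<lambda>u. \<tau> (\<psi> u) / v (\<psi> u))"
proof -
  obtain \<phi> \<psi> where \<phi>: "smooth_on_interval I \<phi>"
      "\<And>s. s \<in> I \<Longrightarrow> (\<phi> has_vector_derivative v s) (at s within I)" "real_interval (\<phi> ` I)"
    and \<psi>: "\<And>s. s \<in> I \<Longrightarrow> \<psi> (\<phi> s) = s"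
      "\<And>s. s \<in> I \<Longrightarrow> (\<psi> has_vector_derivative inverse (v s)) (at (\<phi> s) within \<phi> ` I)"
    using reparametrization_with_speed[OF I v] by blast
  have smooth': "smooth_on_interval (\<phi> ` I) (\<lambda>u. g (\<psi> u))" if "smooth_on_interval I g"
    for g :: "real \<Rightarrow> quat"
    by (rule smooth_on_interval_reparametrized[where p = "\<lambda>s. inverse (v s)", OF I])
      (use that v \<psi> smooth_on_interval_inverse[OF I] in blast)+
  have der': "((\<lambda>u. g (\<psi> u)) has_vector_derivative d) (at (\<phi> s) within \<phi> ` I)"
    if "s \<in> I" "(g has_vector_derivative g') (at s within I)" "d = inverse (v s) *\<^sub>R g'"
    for g :: "real \<Rightarrow> quat" and d g' s
    using has_vector_derivative_reparametrized[OF \<psi>(2)[OF that(1)] \<psi>(1) that(1,2)] that(3) by simp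
  have "quat_frenet_curve (\<phi> ` I) (\<lambda>u. \<beta> (\<psi> u)) (\<lambda>u. T (\<psi> u)) (\<lambda>u. N (\<psi> u)) (\<lambda>u. B (\<psi> u))
      (\<lambda>u. \<kappa> (\<psi> u) / v (\<psi> u)) (\<lambda>u. \<tau> (\<psi> u) / v (\<psi> u))"
    unfolding quat_frenet_curve_def
  proof (intro conjI ballI)
    fix u assume "u \<in> \<phi> ` I"
    then obtain s where s: "s \<in> I" "u = \<phi> s"
      by blast
    have pos: "v s \<noteq> 0"
      using v(2)[OF s(1)] by simp
    show "{\<beta> (\<psi> u), T (\<psi> u), N (\<psi> u), B (\<psi> u)} \<subseteq> spatial_quats"
      "quat_orthonormal (T (\<psi> u)) (N (\<psi> u)) (B (\<psi> u))"
      using spatial[OF s(1)] orth[OF s(1)] by (simp_all add: s \<psi>(1))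
    show "((\<lambda>u. \<beta> (\<psi> u)) has_vector_derivative T (\<psi> u)) (at u within \<phi> ` I)"
      unfolding s(2) by (rule der'[OF s(1) der(1)[OF s(1)]]) (simp add: s(1) \<psi>(1) pos)
    show "((\<lambda>u. T (\<psi> u)) has_vector_derivative (\<kappa> (\<psi> u) / v (\<psi> u)) *\<^sub>R N (\<psi> u))
        (at u within \<phi> ` I)"
      unfolding s(2) by (rule der'[OF s(1) der(2)[OF s(1)]]) (simp add: s(1) \<psi>(1) divide_inverse_commute)
    show "((\<lambda>u. N (\<psi> u)) has_vector_derivative
        - ((\<kappa> (\<psi> u) / v (\<psi> u)) *\<^sub>R T (\<psi> u)) + (\<tau> (\<psi> u) / v (\<psi> u)) *\<^sub>R B (\<psi> u)) (at u within \<phi> ` I)"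
      unfolding s(2) by (rule der'[OF s(1) der(3)[OF s(1)]])
        (simp add: s(1) \<psi>(1) divide_inverse_commute scaleR_right_diff_distrib)
    show "((\<lambda>u. B (\<psi> u)) has_vector_derivative - ((\<tau> (\<psi> u) / v (\<psi> u)) *\<^sub>R N (\<psi> u)))
        (at u within \<phi> ` I)"
      unfolding s(2) by (rule der'[OF s(1) der(4)[OF s(1)]]) (simp add: s(1) \<psi>(1) divide_inverse_commute)
  qed (rule \<phi>(3) smooth' smooth)+
  then show thesis
    using that \<phi>(1,2) \<psi>(1) by blast
qed

text \<open>
  A rotation in the plane of \<open>t\<close> and \<open>b\<close> changes the frame \<open>t, n, b\<close> into \<open>T = v t + w b\<close>,
  \<open>N = - w t + v b\<close> and \<open>n\<close>. The derivative of \<open>T\<close> has the component \<open>v k - w r\<close> along \<open>n\<close>; where it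
  vanishes, \<open>T'\<close> is a multiple of \<open>N\<close>, so that \<open>N\<close> takes the role of the principal normal and \<open>n\<close> that
  of the binormal.
\<close>

lemma rotated_frenet_frame:
  assumes t: "(t has_vector_derivative k *\<^sub>R n s) (at s within I)"
    and n: "(n has_vector_derivative - (k *\<^sub>R t s) + r *\<^sub>R b s) (at s within I)"
    and b: "(b has_vector_derivative - (r *\<^sub>R n s)) (at s within I)"
    and v: "(v has_vector_derivative v') (at s within I)"
    and w: "(w has_vector_derivative w') (at s within I)"
    and unit: "v s * v s + w s * w s = 1" and unit': "v s * v' = - (w s * w')"
    and vk: "v s * k = w s * r"
  defines "T \<equiv> \<lambda>s. v s *\<^sub>R t s + w s *\<^sub>R b s" and "N \<equiv> \<lambda>s. (- 1 * w s) *\<^sub>R t s + v s *\<^sub>R b s"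
    and "\<kappa> \<equiv> v s * w' - w s * v'" and "\<tau> \<equiv> - (w s * k + v s * r)"
  shows "(T has_vector_derivative \<kappa> *\<^sub>R N s) (at s within I)"
    "(N has_vector_derivative - (\<kappa> *\<^sub>R T s) + \<tau> *\<^sub>R n s) (at s within I)"
    "(n has_vector_derivative - (\<tau> *\<^sub>R N s)) (at s within I)"
proof -
  note v = v[folded has_real_derivative_iff_has_vector_derivative]
    and w = w[folded has_real_derivative_iff_has_vector_derivative]
  \<comment> \<open>The coordinates of \<open>T'\<close> and of \<open>n'\<close> with respect to \<open>t, b\<close> are those of multiples of \<open>N\<close>.\<close>
  have \<kappa>: "\<kappa> * v s = w'" "\<kappa> * w s = - v'"
  proof -
    have "\<kappa> * v s = (v s * v s) * w' - w s * (v s * v')"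
      by (simp add: \<kappa>_def algebra_simps)
    also have "\<dots> = (v s * v s + w s * w s) * w'"
      unfolding unit' by (simp add: algebra_simps)
    finally show "\<kappa> * v s = w'"
      by (simp add: unit)
    have ww': "w s * w' = - (v s * v')"
      using unit' by simp
    have "\<kappa> * w s = v s * (w s * w') - (w s * w s) * v'"
      by (simp add: \<kappa>_def algebra_simps)
    also have "\<dots> = - ((v s * v s + w s * w s) * v')"
      unfolding ww' by (simp add: algebra_simps)
    finally show "\<kappa> * w s = - v'"
      by (simp add: unit)
  qed
  have \<tau>: "\<tau> * w s = - k" "\<tau> * v s = - r"
  proof -
    have "\<tau> * w s = - ((w s * w s) * k + v s * (w s * r))"
      by (simp add: \<tau>_def algebra_simps)
    also have "\<dots> = - ((v s * v s + w s * w s) * k)"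
      unfolding vk[symmetric] by (simp add: algebra_simps)
    finally show "\<tau> * w s = - k"
      by (simp add: unit)
    have "\<tau> * v s = - (w s * (v s * k) + (v s * v s) * r)"
      by (simp add: \<tau>_def algebra_simps)
    also have "\<dots> = - ((v s * v s + w s * w s) * r)"
      unfolding vk by (simp add: algebra_simps)
    finally show "\<tau> * v s = - r"
      by (simp add: unit)
  qed
  have "(T has_vector_derivative (v s *\<^sub>R (k *\<^sub>R n s) + v' *\<^sub>R t s) +
      (w s *\<^sub>R (- (r *\<^sub>R n s)) + w' *\<^sub>R b s)) (at s within I)"
    unfolding T_def by (intro has_vector_derivative_add has_vector_derivative_scaleR t b v w)
  moreover have "(v s *\<^sub>R (k *\<^sub>R n s) + v' *\<^sub>R t s) + (w s *\<^sub>R (- (r *\<^sub>R n s)) + w' *\<^sub>R b s) = \<kappa> *\<^sub>R N s"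
    by (simp add: N_def vk \<kappa> scaleR_right_diff_distrib)
  ultimately show "(T has_vector_derivative \<kappa> *\<^sub>R N s) (at s within I)"
    by simp
  have "(N has_vector_derivative ((- 1 * w s) *\<^sub>R (k *\<^sub>R n s) + (- 1 * w') *\<^sub>R t s) +
      (v s *\<^sub>R (- (r *\<^sub>R n s)) + v' *\<^sub>R b s)) (at s within I)"
    unfolding N_def
    by (intro has_vector_derivative_add has_vector_derivative_scaleR t b v DERIV_cmult w)
  moreover have "((- 1 * w s) *\<^sub>R (k *\<^sub>R n s) + (- 1 * w') *\<^sub>R t s) +
      (v s *\<^sub>R (- (r *\<^sub>R n s)) + v' *\<^sub>R b s) = - (\<kappa> *\<^sub>R T s) + \<tau> *\<^sub>R n s"
    by (simp add: T_def \<kappa> scaleR_right_distrib)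
      (simp add: \<tau>_def scaleR_left_distrib scaleR_left_diff_distrib)
  ultimately show "(N has_vector_derivative - (\<kappa> *\<^sub>R T s) + \<tau> *\<^sub>R n s) (at s within I)"
    by simp
  have "- (\<tau> *\<^sub>R N s) = - (k *\<^sub>R t s) + r *\<^sub>R b s"
    by (simp add: N_def \<tau> scaleR_right_diff_distrib)
  then show "(n has_vector_derivative - (\<tau> *\<^sub>R N s)) (at s within I)"
    using n by simp
qed

text \<open>
  The relation makes \<open>1 - lam k\<close> equal to \<open>r\<^sup>2 / (k\<^sup>2 + r\<^sup>2)\<close>, hence positive. The vector
  \<open>(1 - lam k, lam r)\<close> is then \<open>v\<close> times the unit vector \<open>(v, w)\<close>, and \<open>(v, w)\<close> is proportional to
  \<open>(r, k)\<close>.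
\<close>

lemma mannheim_direction:
  fixes k r lam :: real
  assumes r: "r \<noteq> 0" and rel: "k = lam * (k\<^sup>2 + r\<^sup>2)"
  defines "v \<equiv> sqrt (1 - lam * k)" and "w \<equiv> lam * r * inverse (sqrt (1 - lam * k))"
  shows "1 - lam * k > 0" "v * v = 1 - lam * k" "v * w = lam * r" "v * v + w * w = 1" "v * k = w * r"
proof -
  have "(1 - lam * k) * (k\<^sup>2 + r\<^sup>2) = k\<^sup>2 + r\<^sup>2 - k * (lam * (k\<^sup>2 + r\<^sup>2))"
    by (simp add: algebra_simps)
  also have "\<dots> = r\<^sup>2"
    unfolding rel[symmetric] by (simp add: power2_eq_square)
  also have "\<dots> > 0"
    using r by simp
  finally show pos: "1 - lam * k > 0"
    by (metis add_nonneg_nonneg linorder_not_le mult_nonpos_nonneg zero_le_power2)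
  then have v: "v > 0"
    by (simp add: v_def)
  show vv: "v * v = 1 - lam * k"
    using pos by (simp add: v_def)
  show vw: "v * w = lam * r"
    using v unfolding w_def v_def by simp
  have "(lam * r) * (lam * r) = lam * (lam * (k\<^sup>2 + r\<^sup>2)) - (lam * k) * (lam * k)"
    by (simp add: algebra_simps power2_eq_square)
  also have "\<dots> = lam * k * (1 - lam * k)"
    unfolding rel[symmetric] by (simp add: algebra_simps)
  finally have "(v * w) * (v * w) = (1 - v * v) * (v * v)"
    by (simp add: vw vv)
  then have "(v * v + w * w - 1) * (v * v) = 0"
    by (simp add: algebra_simps)
  then show "v * v + w * w = 1"
    using v by simp
  have "v * (v * k - w * r) = (v * v) * k - (v * w) * r"
    by (simp add: algebra_simps)
  also have "\<dots> = k - lam * (k\<^sup>2 + r\<^sup>2)"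
    unfolding vv vw by (simp add: algebra_simps power2_eq_square)
  finally show "v * k = w * r"
    using rel v by simp
qed

lemma curvature_relation_imp_mannheim_curve:
  assumes curve: "spatial_quat_curve I \<alpha> t n b k r"
    and rel: "\<And>s. s \<in> I \<Longrightarrow> k s = lam * ((k s)\<^sup>2 + (r s)\<^sup>2)"
  shows "mannheim_curve I \<alpha> t n b k r"
proof -
  have \<alpha>: "quat_frenet_curve I \<alpha> t n b k r" and nz: "\<And>s. s \<in> I \<Longrightarrow> k s \<noteq> 0 \<and> r s \<noteq> 0"
    using curve by (simp_all add: spatial_quat_curve_def)
  note I = quat_frenet_curve_interval[OF \<alpha>]
  note a = quat_frenet_curveD[OF \<alpha>]
  have sm: "smooth_on_interval I \<alpha>" "smooth_on_interval I t" "smooth_on_interval I n"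
      "smooth_on_interval I b" "smooth_on_interval I k" "smooth_on_interval I r"
    using \<alpha> quat_frenet_curve_smooth_curvatures[OF \<alpha>] by (simp_all add: quat_frenet_curve_def)
  note smooth = smooth_on_interval_add[OF I] smooth_on_interval_scaleR[OF I]
    smooth_on_interval_mult[OF I] smooth_on_interval_const sm
  define v where "v s = sqrt (1 - lam * k s)" for s
  define w where "w s = lam * r s * inverse (v s)" for s
  have q_pos: "1 - lam * k s > 0" if "s \<in> I" for s
    using mannheim_direction(1)[OF _ rel[OF that]] nz[OF that] by simp
  have vw: "v s * v s = 1 - lam * k s" "v s * w s = lam * r s" "v s * v s + w s * w s = 1"
      "v s * k s = w s * r s" if "s \<in> I" for s
    unfolding v_def w_def using mannheim_direction(2-5)[OF _ rel[OF that]] nz[OF that] by simp_all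
  have v_pos: "v s > 0" if "s \<in> I" for s
    using q_pos[OF that] by (simp add: v_def)
  have "smooth_on_interval I (\<lambda>s. 1 + (- lam) * k s)"
    by (intro smooth)
  then have v_smooth: "smooth_on_interval I v"
    unfolding v_def by (intro smooth_on_interval_sqrt[OF I]) (use q_pos in simp_all)
  have w_smooth: "smooth_on_interval I w"
    unfolding w_def by (intro smooth smooth_on_interval_inverse[OF I] v_smooth v_pos)
  obtain v' where v': "\<And>s. s \<in> I \<Longrightarrow> (v has_vector_derivative v' s) (at s within I)"
    using smooth_on_interval_derivativeE[OF v_smooth] by blast
  obtain w' where w': "\<And>s. s \<in> I \<Longrightarrow> (w has_vector_derivative w' s) (at s within I)"
    using smooth_on_interval_derivativeE[OF w_smooth] by blast
  have vv': "v s * v' s = - (w s * w' s)" if s: "s \<in> I" for s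
  proof -
    have "((\<lambda>s. v s * v s + w s * w s) has_vector_derivative
        (v s * v' s + v' s * v s) + (w s * w' s + w' s * w s)) (at s within I)"
      by (intro has_vector_derivative_add has_vector_derivative_mult v' w' s)
    moreover have "((\<lambda>s. v s * v s + w s * w s) has_vector_derivative 0) (at s within I)"
      by (rule has_vector_derivative_transform[where f = "\<lambda>_. 1"]) (simp_all add: s vw(3))
    ultimately have "(v s * v' s + v' s * v s) + (w s * w' s + w' s * w s) = 0"
      by (rule derivative_within_real_interval_unique[OF I s])
    then show ?thesis
      by (simp add: algebra_simps)
  qed
  define \<beta> where "\<beta> s = \<alpha> s + lam *\<^sub>R n s" for s
  define T where "T s = v s *\<^sub>R t s + w s *\<^sub>R b s" for s
  define N where "N s = (- 1 * w s) *\<^sub>R t s + v s *\<^sub>R b s" for s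
  define \<kappa> where "\<kappa> s = v s * w' s - w s * v' s" for s
  define \<tau> where "\<tau> s = - (w s * k s + v s * r s)" for s
  have \<beta>': "(\<beta> has_vector_derivative v s *\<^sub>R T s) (at s within I)" if s: "s \<in> I" for s
  proof -
    have "(\<beta> has_vector_derivative t s + (lam *\<^sub>R (- (k s *\<^sub>R t s) + r s *\<^sub>R b s) + 0 *\<^sub>R n s))
        (at s within I)"
      unfolding \<beta>_def
      by (intro has_vector_derivative_add has_vector_derivative_scaleR a s DERIV_const)
    moreover have "v s *\<^sub>R T s = t s + (lam *\<^sub>R (- (k s *\<^sub>R t s) + r s *\<^sub>R b s) + 0 *\<^sub>R n s)"
      by (simp add: T_def scaleR_right_distrib scaleR_right_diff_distrib scaleR_left_diff_distrib
          vw(1,2)[OF s])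
    ultimately show ?thesis
      by simp
  qed
  have frame: "(T has_vector_derivative \<kappa> s *\<^sub>R N s) (at s within I)"
      "(N has_vector_derivative - (\<kappa> s *\<^sub>R T s) + \<tau> s *\<^sub>R n s) (at s within I)"
      "(n has_vector_derivative - (\<tau> s *\<^sub>R N s)) (at s within I)" if s: "s \<in> I" for s
    unfolding T_def N_def \<kappa>_def \<tau>_def
    by (rule rotated_frenet_frame a(11-13)[OF s] v'[OF s] w'[OF s] vw(3,4)[OF s] vv'[OF s])+
  have frame_smooth: "smooth_on_interval I \<beta>" "smooth_on_interval I T" "smooth_on_interval I N"
    unfolding \<beta>_def T_def N_def by (intro smooth v_smooth w_smooth)+
  have spatial: "{\<beta> s, T s, N s, n s} \<subseteq> spatial_quats" if "s \<in> I" for s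
    using \<alpha> that by (simp add: quat_frenet_curve_def spatial_quats_iff \<beta>_def T_def N_def)
  have orth: "quat_orthonormal (T s) (N s) (n s)" if "s \<in> I" for s
    using vw(3)[OF that] a[OF that]
    by (simp add: quat_orthonormal_iff T_def N_def inner_simps add.commute)
  obtain \<phi> \<psi> where \<phi>: "smooth_on_interval I \<phi>"
      "\<And>s. s \<in> I \<Longrightarrow> (\<phi> has_vector_derivative v s) (at s within I)"
    and \<psi>: "\<And>s. s \<in> I \<Longrightarrow> \<psi> (\<phi> s) = s"
    and partner: "quat_frenet_curve (\<phi> ` I) (\<lambda>u. \<beta> (\<psi> u)) (\<lambda>u. T (\<psi> u)) (\<lambda>u. N (\<psi> u))
      (\<lambda>u. n (\<psi> u)) (\<lambda>u. \<kappa> (\<psi> u) / v (\<psi> u)) (\<lambda>u. \<tau> (\<psi> u) / v (\<psi> u))"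
    using frenet_curve_of_speed[OF I v_smooth v_pos frame_smooth sm(3) spatial orth \<beta>' frame]
    by blast
  have torsion: "\<tau> s \<noteq> 0" if s: "s \<in> I" for s
  proof
    assume "\<tau> s = 0"
    then have "- (k s *\<^sub>R t s) + r s *\<^sub>R b s = 0"
      using derivative_within_real_interval_unique[OF I s a(12)[OF s] frame(3)[OF s]] by simp
    then have "(- (k s *\<^sub>R t s) + r s *\<^sub>R b s) \<bullet> t s = 0"
      by simp
    then show False
      using nz[OF s] by (simp add: inner_simps a s)
  qed
  have line: "line_through (\<alpha> s) (n s) = line_through (\<beta> s) (n s)" for s
  proof -
    have "\<alpha> s + x *\<^sub>R n s = \<beta> s + (x - lam) *\<^sub>R n s" "\<beta> s + x *\<^sub>R n s = \<alpha> s + (x + lam) *\<^sub>R n s" for x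
      by (simp_all add: \<beta>_def algebra_simps)
    then show ?thesis
      unfolding line_through_def by blast
  qed
  show ?thesis
    unfolding mannheim_curve_def
  proof (intro conjI exI)
    show "spatial_quat_curve I \<alpha> t n b k r"
      by (rule curve)
    show "quat_frenet_curve (\<phi> ` I) (\<lambda>u. \<beta> (\<psi> u)) (\<lambda>u. T (\<psi> u)) (\<lambda>u. N (\<psi> u)) (\<lambda>u. n (\<psi> u))
        (\<lambda>u. \<kappa> (\<psi> u) / v (\<psi> u)) (\<lambda>u. \<tau> (\<psi> u) / v (\<psi> u))"
      by (rule partner)
    show "\<forall>u\<in>\<phi> ` I. \<tau> (\<psi> u) / v (\<psi> u) \<noteq> 0"
      using torsion v_pos \<psi> by fastforce
    show "bij_betw \<phi> I (\<phi> ` I)"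
      using \<psi> by (metis bij_betw_imageI inj_on_inverseI)
    show "smooth_on_interval I \<phi>"
      by (rule \<phi>(1))
    show "\<forall>s\<in>I. \<exists>d. d \<noteq> 0 \<and> (\<phi> has_real_derivative d) (at s within I)"
      using \<phi>(2) v_pos unfolding has_real_derivative_iff_has_vector_derivative
      by (metis less_irrefl)
    show "\<forall>s\<in>I. \<exists>x y. (x \<noteq> 0 \<or> y \<noteq> 0) \<and> x *\<^sub>R n s + y *\<^sub>R n (\<psi> (\<phi> s)) = 0"
      using \<psi> by (intro ballI exI[of _ 1] exI[of _ "-1"]) simp
    show "\<forall>s\<in>I. line_through (\<alpha> s) (n s) = line_through (\<beta> (\<psi> (\<phi> s))) (n (\<psi> (\<phi> s)))"
      using \<psi> line by simp
    show "smooth_on_interval I (\<lambda>_. lam)"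
      by (rule smooth_on_interval_const)
    show "\<forall>s\<in>I. \<beta> (\<psi> (\<phi> s)) = \<alpha> s + lam *\<^sub>R n s"
      using \<psi> by (simp add: \<beta>_def)
  qed
qed

theorem theorem3p4:
  fixes I :: "real set" and \<alpha> t n b :: "real \<Rightarrow> quat" and k r :: "real \<Rightarrow> real"
  assumes "spatial_quat_curve I \<alpha> t n b k r"
  shows "mannheim_curve I \<alpha> t n b k r \<longleftrightarrow>
         (\<exists>lam :: real. \<forall>s\<in>I. k s = lam * ((k s)\<^sup>2 + (r s)\<^sup>2))"
  using mannheim_curve_imp_curvature_relation curvature_relation_imp_mannheim_curve[OF assms]
  by blast

end
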